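(* Let $n\ge 1$, let $T>0$, let $A:[0,T]\to\mathbb{R}^{n\times n}$ be a bounded and integrable matrix function such that the initial value problem $\dot\Phi(\tau)=A(\tau)\Phi(\tau)$ for all $\tau\in[0,T]$, $\Phi(0)=I_n$, has a unique differentiable solution $\Phi:[0,T]\to\mathbb{R}^{n\times n}$, and set $\Psi(T):=\Phi(T)$. Let $J\in\mathbb{R}^{n\times n}$ and $M\in\mathbb{S}^n$ be given. Then the following two statements are equivalent: (a) There exist a matrix $P\in\mathbb{S}^n_{\succ0}$ and a scalar $\varepsilon>0$ such that $$J^{\top}\Psi(T)^{\top}P\,\Psi(T)J-J^{\top}PJ+M+\varepsilon I_n\preceq 0 .$$ (b) There exist a matrix $P\in\mathbb{S}^n_{\succ0}$, a scalar $\varepsilon>0$ and differentiable matrix-valued functions $Z_1,Z_2:[0,T]\to\mathbb{S}^n$ such that $$Z_1(T)=0,\qquad J^{\top}Z_1(0)J+Z_2(0)-Z_2(T)=0,$$ and, for all $\tau\in[0,T]$, $$\operatorname{He}\big[(TP+Z_1(\tau))A(\tau)\big]+\dot Z_1(\tau)\preceq 0,\qquad M+\varepsilon I_n+\dot Z_2(\tau)\preceq 0 .$$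
   Context: $\mathbb{S}^n$ denotes the set of real symmetric $n\times n$ matrices and $\mathbb{S}^n_{\succ0}$ the set of (symmetric) positive definite ones. For symmetric $X,Y$, $X\preceq Y$ means that $Y-X$ is positive semidefinite. For a real square matrix $X$, $\operatorname{He}(X):=X+X^{\top}$. A dot denotes the derivative with respect to $\tau$ (one-sided at the endpoints of $[0,T]$). *)

theory Defs imports "HOL-Analysis.Analysis" begin

definition symmetric_matrix :: "real ^ 'n ^ 'n \<Rightarrow> bool" where
  "symmetric_matrix X \<longleftrightarrow> transpose X = X"

definition positive_semidefinite :: "real ^ 'n ^ 'n \<Rightarrow> bool" where
  "positive_semidefinite X \<longleftrightarrow> symmetric_matrix X \<and> (\<forall>v. 0 \<le> v \<bullet> (X *v v))"

definition positive_definite :: "real ^ 'n ^ 'n \<Rightarrow> bool" where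
  "positive_definite X \<longleftrightarrow> symmetric_matrix X \<and> (\<forall>v. v \<noteq> 0 \<longrightarrow> 0 < v \<bullet> (X *v v))"

(* Loewner order; the infix \<le> on real ^ 'n ^ 'n is the entrywise order instead. *)
definition loewner_le :: "real ^ 'n ^ 'n \<Rightarrow> real ^ 'n ^ 'n \<Rightarrow> bool" (infix "\<preceq>\<^sub>L" 50) where
  "X \<preceq>\<^sub>L Y \<longleftrightarrow> symmetric_matrix X \<and> symmetric_matrix Y \<and> positive_semidefinite (Y - X)"

definition He :: "real ^ 'n ^ 'n \<Rightarrow> real ^ 'n ^ 'n" where
  "He X = X + transpose X"

(* The filter "at \<tau> within {0..T}" makes derivatives one-sided at 0 and at T. *)
definition fundamental_solution ::
    "(real \<Rightarrow> real ^ 'n ^ 'n) \<Rightarrow> real \<Rightarrow> (real \<Rightarrow> real ^ 'n ^ 'n) \<Rightarrow> bool" where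
  "fundamental_solution A T \<Phi> \<longleftrightarrow>
     \<Phi> 0 = mat 1 \<and>
     (\<forall>\<tau>\<in>{0..T}. (\<Phi> has_vector_derivative A \<tau> ** \<Phi> \<tau>) (at \<tau> within {0..T}))"

end

theory Submission imports Defs begin

text \<open>
  Put \<open>W = T P + Z\<^sub>1\<close>. Along solutions \<open>u\<close> of \<open>u' = A u\<close> the quadratic form \<open>u\<^sup>T W u\<close> has derivative
  \<open>u\<^sup>T (He (W A) + W') u\<close>. Hence (b) makes it nonincreasing, so
  \<open>T \<Phi>(T)\<^sup>T P \<Phi>(T) \<preceq> T P + Z\<^sub>1(0)\<close>, while the inequality for \<open>Z\<^sub>2\<close> integrates to
  \<open>T (M + \<epsilon> I) \<preceq> Z\<^sub>2(0) - Z\<^sub>2(T)\<close>; congruence with \<open>J\<close>, the coupling condition and division by \<open>T\<close> give (a).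
  Conversely, (a) yields (b) with \<open>W(\<tau>) = T \<Phi>(\<tau>)\<^sup>-\<^sup>T \<Phi>(T)\<^sup>T P \<Phi>(T) \<Phi>(\<tau>)\<^sup>-\<^sup>1\<close>, for which the form is constant,
  and \<open>Z\<^sub>2\<close> linear. The inverse exists since, \<open>A\<close> being bounded, a nonzero solution never vanishes.
\<close>

section \<open>Matrix products as bounded bilinear maps, transposition, and comparison with
  zero\<close>

lemma bounded_bilinear_matrix_mult:
  "bounded_bilinear ((**) :: real ^ 'n ^ 'm \<Rightarrow> real ^ 'p ^ 'n \<Rightarrow> real ^ 'p ^ 'm)"
  unfolding bilinear_conv_bounded_bilinear[symmetric] bilinear_def
  by (intro conjI allI linearI)
    (simp_all add: matrix_matrix_mult_def vec_eq_iff distrib_left distrib_right sum.distrib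
      sum_distrib_left mult_ac)

lemma bounded_bilinear_matrix_vector_mult:
  "bounded_bilinear ((*v) :: real ^ 'n ^ 'm \<Rightarrow> real ^ 'n \<Rightarrow> real ^ 'm)"
  unfolding bilinear_conv_bounded_bilinear[symmetric] bilinear_def
  by (intro conjI allI linearI)
    (simp_all add: matrix_vector_mult_def vec_eq_iff distrib_left distrib_right sum.distrib
      sum_distrib_left mult_ac)

interpretation matrix_mult:
  bounded_bilinear "(**) :: real ^ 'n ^ 'm \<Rightarrow> real ^ 'p ^ 'n \<Rightarrow> real ^ 'p ^ 'm"
  by (rule bounded_bilinear_matrix_mult)

interpretation matrix_vector_mult:
  bounded_bilinear "(*v) :: real ^ 'n ^ 'm \<Rightarrow> real ^ 'n \<Rightarrow> real ^ 'm"
  by (rule bounded_bilinear_matrix_vector_mult)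

lemma linear_transpose: "linear (transpose :: real ^ 'n ^ 'm \<Rightarrow> real ^ 'm ^ 'n)"
  by (auto intro!: linearI simp: transpose_def vec_eq_iff)

lemma transpose_add: "transpose (X + Y) = transpose X + transpose (Y :: real ^ 'n ^ 'm)"
  by (rule linear_add[OF linear_transpose])

lemma transpose_diff: "transpose (X - Y) = transpose X - transpose (Y :: real ^ 'n ^ 'm)"
  by (rule linear_diff[OF linear_transpose])

lemma inner_transpose_mult:
  "v \<bullet> (transpose X *v w) = (X *v v) \<bullet> w" for X :: "real ^ 'n ^ 'm"
  by (metis dot_lmul_matrix inner_commute transpose_matrix_vector)

lemma symmetric_congruence:
  "symmetric_matrix P \<Longrightarrow> symmetric_matrix (transpose X ** P ** X)"
  by (simp add: symmetric_matrix_def matrix_transpose_mul matrix_mul_assoc)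

lemma loewner_le_zeroD:
  "X \<preceq>\<^sub>L 0 \<Longrightarrow> v \<bullet> (X *v v) \<le> 0"
  by (simp add: loewner_le_def positive_semidefinite_def matrix_vector_mult.minus_left)

text \<open>The quadratic form does not see the skew part of \<open>X\<close>, so symmetry is a
  premise of its own.\<close>

lemma loewner_le_zeroI:
  assumes "symmetric_matrix X" "\<And>v. v \<bullet> (X *v v) \<le> 0"
  shows "X \<preceq>\<^sub>L 0"
proof -
  have "transpose (0 - X) = 0 - X"
    using assms(1) linear_neg[OF linear_transpose, of X] by (simp add: symmetric_matrix_def)
  moreover have "transpose (0 :: real ^ 'n ^ 'n) = 0"
    using linear_0[OF linear_transpose] .
  ultimately show ?thesis
    using assms unfolding loewner_le_def positive_semidefinite_def symmetric_matrix_def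
    by (simp add: matrix_vector_mult.minus_left)
qed

section \<open>Monotonicity from derivatives, and the derivative of an inverse matrix\<close>

lemma has_vector_derivative_nonpos_imp_le:
  fixes f :: "real \<Rightarrow> real"
  assumes "a \<le> b"
    and der: "\<And>x. x \<in> {a..b} \<Longrightarrow> (f has_vector_derivative f' x) (at x within {a..b})"
    and "\<And>x. x \<in> {a..b} \<Longrightarrow> f' x \<le> 0"
  shows "f b \<le> f a"
proof -
  \<comment> \<open>The mean value theorem compares the endpoint values directly: no integrability
    of \<open>f'\<close> enters, and one-sided derivatives at \<open>a\<close> and \<open>b\<close>
    suffice.\<close>
  obtain x where "x \<in> {a..b}" "f b - f a = (b - a) * f' x"
    using mvt_very_simple[of a b f "\<lambda>x h. h *\<^sub>R f' x"] assms(1) der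
    unfolding has_vector_derivative_def by auto
  moreover have "(b - a) * f' x \<le> 0"
    using assms(1,3) \<open>x \<in> _\<close> by (simp add: mult_nonneg_nonpos)
  ultimately show ?thesis by simp
qed

text \<open>Turns differentiability into a plain limit, so that the limit rules for matrix products
  can be applied to the quotients of an inverse.\<close>

lemma has_vector_derivative_iff_quotient:
  "(f has_vector_derivative D) (at t within S) \<longleftrightarrow>
    ((\<lambda>s. (1 / (s - t)) *\<^sub>R (f s - f t)) \<longlongrightarrow> D) (at t within S)"
proof -
  let ?q = "\<lambda>s. (1 / (s - t)) *\<^sub>R (f s - f t)"
  have eq: "norm (f s - f t - (s - t) *\<^sub>R D) / norm (s - t) = norm (?q s - D)" if "s \<noteq> t" for s
  proof -
    have "f s - f t - (s - t) *\<^sub>R D = (s - t) *\<^sub>R (?q s - D)"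
      using that by (simp add: scaleR_diff_right)
    then show ?thesis using that by simp
  qed
  have "(f has_vector_derivative D) (at t within S) \<longleftrightarrow>
      ((\<lambda>s. norm (f s - f t - (s - t) *\<^sub>R D) / norm (s - t)) \<longlongrightarrow> 0) (at t within S)"
    by (simp add: has_vector_derivative_def has_derivative_iff_norm bounded_linear_scaleR_left)
  also have "\<dots> \<longleftrightarrow> ((\<lambda>s. norm (?q s - D)) \<longlongrightarrow> 0) (at t within S)"
    by (rule filterlim_cong[OF refl refl]) (use eq in \<open>auto simp: eventually_at_filter\<close>)
  also have "\<dots> \<longleftrightarrow> (?q \<longlongrightarrow> D) (at t within S)"
    by (simp only: tendsto_norm_zero_iff Lim_null[symmetric])
  finally show ?thesis .
qed

text \<open>
  Continuity of the inverse is not assumed: \<open>Y s - Y t = - Y s (X s - X t) Y t\<close> gives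
  \<open>\<bar>Y s\<bar> \<le> 2 \<bar>Y t\<bar>\<close> near \<open>t\<close>, hence continuity, and then the derivative.
\<close>

lemma has_vector_derivative_matrix_inverse:
  fixes X Y :: "real \<Rightarrow> real ^ 'n ^ 'n"
  assumes X: "(X has_vector_derivative X') (at t within S)" and "t \<in> S"
    and inv: "\<And>s. s \<in> S \<Longrightarrow> X s ** Y s = mat 1" "\<And>s. s \<in> S \<Longrightarrow> Y s ** X s = mat 1"
  shows "(Y has_vector_derivative - (Y t ** X' ** Y t)) (at t within S)"
proof -
  let ?F = "at t within S"
  have diff: "Y s - Y t = - (Y s ** (X s - X t) ** Y t)" if "s \<in> S" for s
  proof -
    have "Y s ** (X s - X t) ** Y t = Y s ** X s ** Y t - Y s ** (X t ** Y t)"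
      by (simp add: matrix_mult.diff_left matrix_mult.diff_right matrix_mul_assoc)
    then show ?thesis using inv that \<open>t \<in> S\<close> by simp
  qed
  have inS: "eventually (\<lambda>s. s \<in> S) ?F"
    by (simp add: eventually_at_filter)
  have X0: "((\<lambda>s. X s - X t) \<longlongrightarrow> 0) ?F"
    using has_vector_derivative_continuous[OF X] by (simp add: continuous_within LIM_zero)
  obtain K where K: "K > 0" "\<And>(a :: real ^ 'n ^ 'n) (b :: real ^ 'n ^ 'n). norm (a ** b) \<le> norm a * norm b * K"
    using matrix_mult.pos_bounded by blast
  have "((\<lambda>s. norm ((X s - X t) ** Y t) * K) \<longlongrightarrow> 0) ?F"
    by (intro tendsto_mult_left_zero tendsto_norm_zero matrix_mult.tendsto_left_zero X0)
  \<comment> \<open>With the threshold 1/2, half of \<open>norm (Y s)\<close> can be absorbed on the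
    left below, which yields the factor 2.\<close>
  then have "eventually (\<lambda>s. norm ((X s - X t) ** Y t) * K < 1 / 2) ?F"
    by (rule order_tendstoD(2)) simp
  then have "eventually (\<lambda>s. norm (Y s) \<le> 2 * norm (Y t)) ?F"
    using inS
  proof eventually_elim
    case (elim s)
    have "norm (Y s) - norm (Y t) \<le> norm (Y s - Y t)"
      by (rule norm_triangle_ineq2)
    also have "\<dots> \<le> norm (Y s) * norm ((X s - X t) ** Y t) * K"
      unfolding diff[OF elim(2)] norm_minus_cancel matrix_mul_assoc[symmetric] by (rule K)
    also have "\<dots> \<le> norm (Y s) * (1 / 2)"
      using mult_left_mono[of "norm ((X s - X t) ** Y t) * K" "1 / 2" "norm (Y s)"] elim(1)
      by (simp add: mult.assoc)
    finally show ?case by simp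
  qed
  then have "Bfun Y ?F"
    by (rule BfunI)
  \<comment> \<open>A bounded factor times one tending to zero tends to zero.\<close>
  then have "Zfun (\<lambda>s. Y s ** ((X s - X t) ** Y t)) ?F"
    by (intro matrix_mult.Bfun_prod_Zfun matrix_mult.Zfun_left)
      (use X0 in \<open>simp_all add: tendsto_Zfun_iff\<close>)
  then have "Zfun (\<lambda>s. - (Y s ** (X s - X t) ** Y t)) ?F"
    by (intro Zfun_minus) (simp add: matrix_mul_assoc)
  moreover have "eventually (\<lambda>s. Y s - Y t = - (Y s ** (X s - X t) ** Y t)) ?F"
    using inS by eventually_elim (rule diff)
  ultimately have Y: "(Y \<longlongrightarrow> Y t) ?F"
    unfolding tendsto_Zfun_iff Zfun_def by (auto elim: eventually_elim2)
  have "((\<lambda>s. (1 / (s - t)) *\<^sub>R (X s - X t)) \<longlongrightarrow> X') ?F"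
    using X unfolding has_vector_derivative_iff_quotient .
  then have "((\<lambda>s. - (Y s ** ((1 / (s - t)) *\<^sub>R (X s - X t)) ** Y t)) \<longlongrightarrow> - (Y t ** X' ** Y t)) ?F"
    by (intro tendsto_minus matrix_mult.tendsto Y tendsto_const)
  moreover have "eventually (\<lambda>s. - (Y s ** ((1 / (s - t)) *\<^sub>R (X s - X t)) ** Y t)
      = (1 / (s - t)) *\<^sub>R (Y s - Y t)) ?F"
    using inS by eventually_elim (simp add: diff matrix_mult.scaleR_left matrix_mult.scaleR_right)
  ultimately have "((\<lambda>s. (1 / (s - t)) *\<^sub>R (Y s - Y t)) \<longlongrightarrow> - (Y t ** X' ** Y t)) ?F"
    by (rule Lim_transform_eventually)
  then show ?thesis
    unfolding has_vector_derivative_iff_quotient .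
qed

section \<open>Quadratic forms and invertibility along linear differential equations\<close>

lemma quadratic_form_has_vector_derivative:
  fixes A W :: "real \<Rightarrow> real ^ 'n ^ 'n"
  assumes u: "(u has_vector_derivative A t *v u t) (at t within S)"
    and W: "(W has_vector_derivative W') (at t within S)"
    and sym: "symmetric_matrix (W t)"
  shows "((\<lambda>s. u s \<bullet> (W s *v u s)) has_vector_derivative
    u t \<bullet> ((He (W t ** A t) + W') *v u t)) (at t within S)"
proof -
  \<comment> \<open>The product rule differentiates both copies of \<open>u\<close>. Symmetry of
    \<open>W t\<close> turns the term from the left copy into the transposed half of
    \<open>He (W t ** A t)\<close>.\<close>
  have "(A t *v u t) \<bullet> (W t *v u t) = u t \<bullet> (transpose (A t) *v (W t *v u t))"
    by (simp only: inner_transpose_mult)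
  also have "\<dots> = u t \<bullet> (transpose (W t ** A t) *v u t)"
    using sym by (simp add: symmetric_matrix_def matrix_transpose_mul matrix_vector_mul_assoc
        del: transpose_matrix_vector)
  finally show ?thesis
    by (intro has_vector_derivative_eq_rhs[OF bounded_bilinear.has_vector_derivative[OF
          bounded_bilinear_inner u matrix_vector_mult.has_vector_derivative[OF W u]]])
      (simp add: He_def matrix_vector_mult_add_rdistrib inner_add_right matrix_vector_mul_assoc
        del: transpose_matrix_vector)
qed

text \<open>The derivative of \<open>u \<bullet> u\<close> is at least \<open>- 2 * C\<close> times
  \<open>u \<bullet> u\<close>, so \<open>exp (2 * C * t) * (u t \<bullet> u t)\<close> cannot
  decrease from its positive value at 0.\<close>

lemma linear_ode_nonzero:
  fixes A :: "real \<Rightarrow> real ^ 'n ^ 'n"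
  assumes bdd: "bounded (A ` {0..T})"
    and u: "\<And>t. t \<in> {0..T} \<Longrightarrow> (u has_vector_derivative A t *v u t) (at t within {0..T})"
    and "u 0 \<noteq> 0" "s \<in> {0..T}"
  shows "u s \<noteq> 0"
proof -
  obtain K where K: "K > 0" "\<And>(a :: real ^ 'n ^ 'n) b. norm (a *v b) \<le> norm a * norm b * K"
    using matrix_vector_mult.pos_bounded by blast
  obtain B where B: "\<And>t. t \<in> {0..T} \<Longrightarrow> norm (A t) \<le> B"
    using bdd unfolding bounded_iff by blast
  \<comment> \<open>\<open>B\<close> bounds the norm of \<open>A\<close> on the interval;
    \<open>K\<close> is the constant in the bound for the bilinear matrix-vector product.\<close>
  define C where "C = B * K"
  have AC: "- (u t \<bullet> (A t *v u t)) \<le> C * (u t \<bullet> u t)" if "t \<in> {0..T}" for t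
  proof -
    have "- (u t \<bullet> (A t *v u t)) \<le> norm (u t) * norm (A t *v u t)"
      using Cauchy_Schwarz_ineq2[of "u t" "A t *v u t"] by linarith
    also have "\<dots> \<le> norm (u t) * (norm (A t) * norm (u t) * K)"
      by (intro mult_left_mono K) simp
    also have "\<dots> \<le> norm (u t) * (B * norm (u t) * K)"
      using B[OF that] K by (intro mult_left_mono mult_right_mono) auto
    finally show ?thesis
      by (simp add: C_def dot_square_norm power2_eq_square mult_ac)
  qed
  let ?h = "\<lambda>t. - (exp (2 * C * t) * (u t \<bullet> u t))"
  have "?h s \<le> ?h 0"
  proof (rule has_vector_derivative_nonpos_imp_le[where f = ?h])
    fix t assume t: "t \<in> {0..s}"
    then have tT: "t \<in> {0..T}" using assms(4) by simp
    have ut: "(u has_vector_derivative A t *v u t) (at t within {0..s})"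
      using u[OF tT] by (rule has_vector_derivative_within_subset) (use assms(4) in auto)
    have e: "((\<lambda>t. exp (2 * C * t)) has_vector_derivative 2 * C * exp (2 * C * t)) (at t within {0..s})"
      unfolding has_real_derivative_iff_has_vector_derivative[symmetric]
      by (auto intro!: derivative_eq_intros)
    show "(?h has_vector_derivative
        - (2 * exp (2 * C * t) * (C * (u t \<bullet> u t) + u t \<bullet> (A t *v u t)))) (at t within {0..s})"
      by (rule has_vector_derivative_eq_rhs, rule has_vector_derivative_minus,
          rule has_vector_derivative_mult[OF e bounded_bilinear.has_vector_derivative[OF
            bounded_bilinear_inner ut ut]])
        (simp add: algebra_simps inner_commute)
    show "- (2 * exp (2 * C * t) * (C * (u t \<bullet> u t) + u t \<bullet> (A t *v u t))) \<le> 0"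
      using AC[OF tT] by simp
  qed (use assms(4) in auto)
  moreover have "0 < exp (2 * C * 0) * (u 0 \<bullet> u 0)"
    using \<open>u 0 \<noteq> 0\<close> by simp
  ultimately have "0 < exp (2 * C * s) * (u s \<bullet> u s)"
    by linarith
  then show ?thesis by auto
qed

lemma fundamental_solution_vector:
  assumes "fundamental_solution A T \<Phi>" "t \<in> {0..T}"
  shows "((\<lambda>s. \<Phi> s *v v) has_vector_derivative A t *v (\<Phi> t *v v)) (at t within {0..T})"
  using bounded_linear.has_vector_derivative[OF matrix_vector_mult.bounded_linear_left, of \<Phi>] assms
  by (simp add: fundamental_solution_def matrix_vector_mul_assoc)

text \<open>If \<open>\<Phi> s\<close> kills \<open>v\<close>, the solution
  \<open>\<Phi> *v v\<close> vanishes at \<open>s\<close>, which forces its initial value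
  \<open>v\<close> to be 0. The derivative \<open>- Y (A \<Phi>) Y\<close> of the inverse collapses
  to \<open>- Y A\<close> because \<open>\<Phi> Y\<close> is the identity.\<close>

lemma fundamental_solution_inverse:
  assumes "fundamental_solution A T \<Phi>" "bounded (A ` {0..T})"
  obtains Y where "\<And>s. s \<in> {0..T} \<Longrightarrow> \<Phi> s ** Y s = mat 1"
    and "\<And>s. s \<in> {0..T} \<Longrightarrow> Y s ** \<Phi> s = mat 1"
    and "\<And>t. t \<in> {0..T} \<Longrightarrow> (Y has_vector_derivative - (Y t ** A t)) (at t within {0..T})"
proof -
  have "v = 0" if "s \<in> {0..T}" "\<Phi> s *v v = 0" for s v
    using linear_ode_nonzero[OF assms(2) fundamental_solution_vector[OF assms(1), of _ v], of s] that assms(1)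
    by (auto simp: fundamental_solution_def)
  then have "\<forall>s\<in>{0..T}. invertible (\<Phi> s)"
    unfolding invertible_left_inverse matrix_left_invertible_ker by blast
  then obtain Y where Y: "\<And>s. s \<in> {0..T} \<Longrightarrow> \<Phi> s ** Y s = mat 1" "\<And>s. s \<in> {0..T} \<Longrightarrow> Y s ** \<Phi> s = mat 1"
    unfolding invertible_def by metis
  moreover have "(Y has_vector_derivative - (Y t ** A t)) (at t within {0..T})" if "t \<in> {0..T}" for t
  proof -
    have "(Y has_vector_derivative - (Y t ** (A t ** \<Phi> t) ** Y t)) (at t within {0..T})"
      using assms(1) that
      by (intro has_vector_derivative_matrix_inverse[where X = \<Phi>] Y) (auto simp: fundamental_solution_def)
    moreover have "Y t ** (A t ** \<Phi> t) ** Y t = Y t ** A t"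
      using Y(1)[OF that] by (simp flip: matrix_mul_assoc)
    ultimately show ?thesis by simp
  qed
  ultimately show thesis by (rule that)
qed

theorem theorem3p1:
  fixes T :: real
    and A \<Phi> :: "real \<Rightarrow> real ^ 'n ^ 'n"
    and J M :: "real ^ 'n ^ 'n"
  assumes T_pos: "T > 0"
    and A_bounded: "bounded (A ` {0..T})"
    and A_integrable: "A absolutely_integrable_on {0..T}"
    and solution: "fundamental_solution A T \<Phi>"
    and unique: "\<And>\<Phi>'. fundamental_solution A T \<Phi>' \<Longrightarrow> \<forall>\<tau>\<in>{0..T}. \<Phi>' \<tau> = \<Phi> \<tau>"
    and M_sym: "symmetric_matrix M"
  shows
    "(\<exists>P \<epsilon>. positive_definite P \<and> \<epsilon> > 0 \<and>
        transpose J ** transpose (\<Phi> T) ** P ** \<Phi> T ** J - transpose J ** P ** J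
          + M + \<epsilon> *\<^sub>R mat 1 \<preceq>\<^sub>L 0)
     \<longleftrightarrow>
     (\<exists>P \<epsilon> Z1 Z2. positive_definite P \<and> \<epsilon> > 0 \<and>
        Z1 differentiable_on {0..T} \<and> Z2 differentiable_on {0..T} \<and>
        (\<forall>\<tau>\<in>{0..T}. symmetric_matrix (Z1 \<tau>) \<and> symmetric_matrix (Z2 \<tau>)) \<and>
        Z1 T = 0 \<and>
        transpose J ** Z1 0 ** J + Z2 0 - Z2 T = 0 \<and>
        (\<forall>\<tau>\<in>{0..T}.
           He ((T *\<^sub>R P + Z1 \<tau>) ** A \<tau>) + vector_derivative Z1 (at \<tau> within {0..T}) \<preceq>\<^sub>L 0 \<and>
           M + \<epsilon> *\<^sub>R mat 1 + vector_derivative Z2 (at \<tau> within {0..T}) \<preceq>\<^sub>L 0))"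
    (is "?a \<longleftrightarrow> ?b")
proof

  \<comment> \<open>From (a) to (b): explicit witnesses\<close>
  assume ?a
  then obtain P \<epsilon> where P: "positive_definite P" "\<epsilon> > 0"
    and le: "transpose J ** transpose (\<Phi> T) ** P ** \<Phi> T ** J - transpose J ** P ** J
      + M + \<epsilon> *\<^sub>R mat 1 \<preceq>\<^sub>L 0" by blast
  have symP: "symmetric_matrix P" using P by (simp add: positive_definite_def)
  obtain Y where Y: "\<And>s. s \<in> {0..T} \<Longrightarrow> \<Phi> s ** Y s = mat 1"
      "\<And>s. s \<in> {0..T} \<Longrightarrow> Y s ** \<Phi> s = mat 1"
    and Y': "\<And>t. t \<in> {0..T} \<Longrightarrow> (Y has_vector_derivative - (Y t ** A t)) (at t within {0..T})"
    using fundamental_solution_inverse[OF solution A_bounded] by metis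
  define R where "R = transpose (\<Phi> T) ** P ** \<Phi> T"
  \<comment> \<open>The solution through \<open>v\<close> at time \<open>t\<close> reaches
    \<open>\<Phi> T ** Y t *v v\<close> at time \<open>T\<close>, so the form of \<open>W t\<close>
    at \<open>v\<close> is \<open>T\<close> times the \<open>P\<close>-form of that end state. This
    is why it is constant along solutions.\<close>
  define W where "W t = T *\<^sub>R (transpose (Y t) ** R ** Y t)" for t
  \<comment> \<open>The slope of \<open>Z2\<close>. As \<open>Z1 0\<close> will be
    \<open>T *\<^sub>R (R - P)\<close>, the coupling condition asks \<open>Z2\<close> to grow by
    \<open>T *\<^sub>R D\<close> over the interval, and (a) reads
    \<open>D + M + \<epsilon> *\<^sub>R mat 1 \<preceq>\<^sub>L 0\<close>.\<close>
  define D where "D = transpose J ** (R - P) ** J"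
  have symR: "symmetric_matrix R" unfolding R_def by (rule symmetric_congruence[OF symP])
  have symD: "symmetric_matrix D" unfolding D_def
    by (rule symmetric_congruence) (use symR symP in \<open>simp add: symmetric_matrix_def transpose_diff\<close>)
  have symW: "transpose (W t) = W t" for t
    using symmetric_congruence[OF symR, of "Y t"] by (simp add: W_def symmetric_matrix_def transpose_scalar)
  have W0: "W 0 = T *\<^sub>R R"
  proof -
    have "Y 0 = mat 1" using Y(2)[of 0] solution T_pos by (simp add: fundamental_solution_def)
    then show ?thesis by (simp add: W_def)
  qed
  have WT: "W T = T *\<^sub>R P"
  proof -
    have "transpose (Y T) ** R ** Y T = transpose (\<Phi> T ** Y T) ** P ** (\<Phi> T ** Y T)"
      by (simp add: R_def matrix_transpose_mul matrix_mul_assoc)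
    then show ?thesis using Y(1)[of T] T_pos by (simp add: W_def)
  qed
  \<comment> \<open>Inserting \<open>Y' = - Y A\<close> on both sides of \<open>R\<close> gives
    \<open>- (W A + A\<^sup>T W)\<close>, and \<open>W\<close> is symmetric.\<close>
  have W': "(W has_vector_derivative - He (W t ** A t)) (at t within {0..T})" if "t \<in> {0..T}" for t
  proof -
    have "((\<lambda>s. T *\<^sub>R (transpose (Y s) ** R ** Y s)) has_vector_derivative
      T *\<^sub>R (transpose (Y t) ** R ** (- (Y t ** A t)) + transpose (- (Y t ** A t)) ** R ** Y t))
      (at t within {0..T})"
      by (intro bounded_linear.has_vector_derivative[OF bounded_linear_scaleR_right]
          matrix_mult.has_vector_derivative Y'[OF that]
          bounded_linear.has_vector_derivative[OF matrix_mult.bounded_linear_left]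
          bounded_linear.has_vector_derivative[OF linear_transpose[unfolded linear_conv_bounded_linear]])
    moreover have "He (W t ** A t) = W t ** A t + transpose (A t) ** W t"
      by (simp add: He_def matrix_transpose_mul symW)
    ultimately show ?thesis
      unfolding W_def[abs_def]
      by (simp add: matrix_mult.minus_left matrix_mult.minus_right linear_neg[OF linear_transpose]
          matrix_transpose_mul matrix_mult.scaleR_left matrix_mult.scaleR_right scaleR_diff_right matrix_mul_assoc)
  qed
  define Z1 where "Z1 t = W t - T *\<^sub>R P" for t
  define Z2 where "Z2 t = t *\<^sub>R D" for t
  have Z1': "(Z1 has_vector_derivative - He (W t ** A t)) (at t within {0..T})" if "t \<in> {0..T}" for t
    unfolding Z1_def[abs_def] has_vector_derivative_diff_const by (rule W'[OF that])
  have Z2': "(Z2 has_vector_derivative D) (at t within {0..T})" for t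
    unfolding Z2_def[abs_def] by (auto intro!: derivative_eq_intros)
  \<comment> \<open>\<open>T > 0\<close> makes the interval nondegenerate, so one-sided derivatives
    are unique and \<open>vector_derivative\<close> picks the one found above.\<close>
  have vd1: "vector_derivative Z1 (at t within {0..T}) = - He (W t ** A t)" if "t \<in> {0..T}" for t
    using vector_derivative_within_closed_interval[OF T_pos that Z1'[OF that]] .
  have vd2: "vector_derivative Z2 (at t within {0..T}) = D" if "t \<in> {0..T}" for t
    using vector_derivative_within_closed_interval[OF T_pos that Z2'] .
  show ?b
  proof (intro exI conjI ballI)
    show "positive_definite P" "\<epsilon> > 0" by fact+
    show "Z1 differentiable_on {0..T}" "Z2 differentiable_on {0..T}"
      unfolding differentiable_on_def using Z1' Z2' differentiableI_vector by blast+
    show "Z1 T = 0" by (simp add: Z1_def WT)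
    show "transpose J ** Z1 0 ** J + Z2 0 - Z2 T = 0"
      by (simp add: Z1_def W0 Z2_def D_def matrix_mult.diff_left matrix_mult.diff_right
          matrix_mult.scaleR_left matrix_mult.scaleR_right algebra_simps)
  next
    fix t assume t: "t \<in> {0..T}"
    show "symmetric_matrix (Z1 t)" "symmetric_matrix (Z2 t)"
      using symD symP
      by (simp_all add: Z1_def Z2_def symmetric_matrix_def transpose_diff transpose_scalar symW)
    \<comment> \<open>Here \<open>T *\<^sub>R P + Z1 t\<close> is \<open>W t\<close>, so the left
      side is exactly 0.\<close>
    show "He ((T *\<^sub>R P + Z1 t) ** A t) + vector_derivative Z1 (at t within {0..T}) \<preceq>\<^sub>L 0"
      unfolding vd1[OF t]
      by (rule loewner_le_zeroI) (simp_all add: Z1_def symmetric_matrix_def linear_0[OF linear_transpose])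
    show "M + \<epsilon> *\<^sub>R mat 1 + vector_derivative Z2 (at t within {0..T}) \<preceq>\<^sub>L 0"
      unfolding vd2[OF t] using le
      by (simp add: D_def R_def matrix_mult.diff_left matrix_mult.diff_right matrix_mul_assoc algebra_simps)
  qed
next

  \<comment> \<open>From (b) to (a): nonincreasing quadratic forms\<close>
  assume ?b
  then obtain P \<epsilon> Z1 Z2 where P: "positive_definite P" "\<epsilon> > 0"
    and diff: "Z1 differentiable_on {0..T}" "Z2 differentiable_on {0..T}"
    and sym: "\<And>t. t \<in> {0..T} \<Longrightarrow> symmetric_matrix (Z1 t)"
    and Z1T: "Z1 T = 0" and coupling: "transpose J ** Z1 0 ** J + Z2 0 - Z2 T = 0"
    and le1: "\<And>t. t \<in> {0..T} \<Longrightarrow>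
      He ((T *\<^sub>R P + Z1 t) ** A t) + vector_derivative Z1 (at t within {0..T}) \<preceq>\<^sub>L 0"
    and le2: "\<And>t. t \<in> {0..T} \<Longrightarrow> M + \<epsilon> *\<^sub>R mat 1 + vector_derivative Z2 (at t within {0..T}) \<preceq>\<^sub>L 0"
    by blast
  have symP: "symmetric_matrix P" using P by (simp add: positive_definite_def)
  have Z': "(Z1 has_vector_derivative vector_derivative Z1 (at t within {0..T})) (at t within {0..T})"
    "(Z2 has_vector_derivative vector_derivative Z2 (at t within {0..T})) (at t within {0..T})"
    if "t \<in> {0..T}" for t
    using diff that by (auto simp: differentiable_on_def vector_derivative_works)
  let ?L = "transpose J ** transpose (\<Phi> T) ** P ** \<Phi> T ** J - transpose J ** P ** J + M + \<epsilon> *\<^sub>R mat 1"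
  have flow: "T * ((\<Phi> T *v w) \<bullet> (P *v (\<Phi> T *v w))) \<le> T * (w \<bullet> (P *v w)) + w \<bullet> (Z1 0 *v w)" for w
  proof -
    \<comment> \<open>The endpoint values give the claim: \<open>?u 0 = w\<close>, and
      \<open>?W T\<close> is \<open>T *\<^sub>R P\<close> since \<open>Z1 T = 0\<close>.\<close>
    let ?W = "\<lambda>t. T *\<^sub>R P + Z1 t" and ?u = "\<lambda>t. \<Phi> t *v w"
    have "?u T \<bullet> (?W T *v ?u T) \<le> ?u 0 \<bullet> (?W 0 *v ?u 0)"
    proof (rule has_vector_derivative_nonpos_imp_le[where f = "\<lambda>t. ?u t \<bullet> (?W t *v ?u t)"])
      fix t assume t: "t \<in> {0..T}"
      show "((\<lambda>t. ?u t \<bullet> (?W t *v ?u t)) has_vector_derivative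
          ?u t \<bullet> ((He (?W t ** A t) + vector_derivative Z1 (at t within {0..T})) *v ?u t)) (at t within {0..T})"
      proof (rule quadratic_form_has_vector_derivative)
        show "(?W has_vector_derivative vector_derivative Z1 (at t within {0..T})) (at t within {0..T})"
          using has_vector_derivative_add[OF has_vector_derivative_const Z'(1)[OF t]] by simp
        show "symmetric_matrix (?W t)"
          using symP sym[OF t] by (simp add: symmetric_matrix_def transpose_add transpose_scalar)
      qed (rule fundamental_solution_vector[OF solution t])
      show "?u t \<bullet> ((He (?W t ** A t) + vector_derivative Z1 (at t within {0..T})) *v ?u t) \<le> 0"
        by (rule loewner_le_zeroD[OF le1[OF t]])
    qed (use T_pos in simp)
    then show ?thesis
      using solution Z1T
      by (simp add: fundamental_solution_def matrix_vector_mult_add_rdistrib inner_add_right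
          matrix_vector_mult.scaleR_left)
  qed
  have Z2_le: "v \<bullet> (Z2 T *v v) + T * (v \<bullet> ((M + \<epsilon> *\<^sub>R mat 1) *v v)) \<le> v \<bullet> (Z2 0 *v v)" for v
  proof -
    \<comment> \<open>The added linear term makes the derivative the form bounded in
      \<open>le2\<close>, so monotonicity takes the place of integrating that inequality.\<close>
    let ?f = "\<lambda>t. v \<bullet> ((Z2 t + t *\<^sub>R (M + \<epsilon> *\<^sub>R mat 1)) *v v)"
    have "?f T \<le> ?f 0"
    proof (rule has_vector_derivative_nonpos_imp_le[where f = ?f])
      fix t assume t: "t \<in> {0..T}"
      have "((\<lambda>t. Z2 t + t *\<^sub>R (M + \<epsilon> *\<^sub>R mat 1)) has_vector_derivative
          vector_derivative Z2 (at t within {0..T}) + (M + \<epsilon> *\<^sub>R mat 1)) (at t within {0..T})"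
        using has_vector_derivative_scaleR[OF DERIV_ident has_vector_derivative_const]
        by (intro has_vector_derivative_add Z'(2)[OF t]) simp
      then have "(?f has_vector_derivative
          v \<bullet> ((vector_derivative Z2 (at t within {0..T}) + (M + \<epsilon> *\<^sub>R mat 1)) *v v)) (at t within {0..T})"
        by (intro bounded_linear.has_vector_derivative[OF bounded_linear_inner_right]
            bounded_linear.has_vector_derivative[OF matrix_vector_mult.bounded_linear_left])
      then show "(?f has_vector_derivative
          v \<bullet> ((M + \<epsilon> *\<^sub>R mat 1 + vector_derivative Z2 (at t within {0..T})) *v v)) (at t within {0..T})"
        by (simp only: add.commute[of "vector_derivative Z2 (at t within {0..T})"])
      show "v \<bullet> ((M + \<epsilon> *\<^sub>R mat 1 + vector_derivative Z2 (at t within {0..T})) *v v) \<le> 0"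
        by (rule loewner_le_zeroD[OF le2[OF t]])
    qed (use T_pos in simp)
    then show ?thesis
      by (simp add: matrix_vector_mult.add_left inner_add_right matrix_vector_mult.scaleR_left algebra_simps)
  qed
  have "?L \<preceq>\<^sub>L 0"
  proof (rule loewner_le_zeroI)
    show "symmetric_matrix ?L"
      using symP M_sym by (simp add: symmetric_matrix_def transpose_add transpose_diff transpose_scalar
          matrix_transpose_mul matrix_mul_assoc)
    fix v
    have "v \<bullet> ((transpose J ** Z1 0 ** J + Z2 0 - Z2 T) *v v) = 0"
      by (simp add: coupling)
    \<comment> \<open>Evaluated at \<open>v\<close>, the coupling cancels every \<open>Z1\<close>
      and \<open>Z2\<close> term when \<open>flow\<close> at \<open>J *v v\<close> and
      \<open>Z2_le\<close> at \<open>v\<close> are added; a common factor \<open>T\<close>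
      remains.\<close>
    then have "(J *v v) \<bullet> (Z1 0 *v (J *v v)) + v \<bullet> (Z2 0 *v v) - v \<bullet> (Z2 T *v v) = 0"
      by (simp add: matrix_vector_mult.add_left matrix_vector_mult.diff_left inner_add_right inner_diff_right
          inner_transpose_mult matrix_vector_mul_assoc[symmetric] del: transpose_matrix_vector)
    then have "T * ((\<Phi> T *v (J *v v)) \<bullet> (P *v (\<Phi> T *v (J *v v))) - (J *v v) \<bullet> (P *v (J *v v))
        + v \<bullet> ((M + \<epsilon> *\<^sub>R mat 1) *v v)) \<le> 0"
      using flow[of "J *v v"] Z2_le[of v] by (simp add: algebra_simps)
    then have "(\<Phi> T *v (J *v v)) \<bullet> (P *v (\<Phi> T *v (J *v v))) - (J *v v) \<bullet> (P *v (J *v v))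
        + v \<bullet> ((M + \<epsilon> *\<^sub>R mat 1) *v v) \<le> 0"
      using T_pos by (simp add: mult_le_0_iff)
    then show "v \<bullet> (?L *v v) \<le> 0"
      by (simp add: matrix_vector_mult.add_left matrix_vector_mult.diff_left inner_add_right inner_diff_right
          inner_transpose_mult matrix_vector_mul_assoc[symmetric] del: transpose_matrix_vector)
  qed
  with P show ?a by (intro exI conjI)
qed

end
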